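(* Let $V$ be a finite-dimensional complex inner product space with $\dim V>1$, let $p$ be a prime, and let $G=T_{4n}\le S_{4n}$ where $2n=lp^t$ with $l$ an integer not divisible by $p$. Let $1\le b<\frac l2$ and let $\phi=\hat\psi_b$ (if $n$ is even) or $\phi=\hat\psi'_b$ (if $n$ is odd). Then $V_\phi(G)$ has an o-basis if and only if $\nu_2\!\left(\frac{2b}{l}\right)<0$.
   Context: The dicyclic group is $T_{4n}=\langle r,s\mid r^{2n}=e,\ r^n=s^2,\ s^{-1}rs=r^{-1}\rangle=\{r^i,sr^i:0\le i<2n\}$. It is embedded in $S_{4n}$ (Cayley) by $r=(1\,2\cdots 2n)(2n+1\ \ 2n+2\cdots 4n)$ and $s=(1\ \ 2n+1\ \ n+1\ \ 3n+1)\prod_{i=2}^{n}(i\ \ 4n+2-i\ \ n+i\ \ 3n+2-i)$. $\nu_2$ is the 2-adic valuation on $\mathbb{Q}$. For $1\le j\le n-1$ the two-dimensional irreducible character $\psi_j$ ($n$ even), resp. $\psi'_j$ ($n$ odd), of $T_{4n}$ takes the value $2\cos(kj\pi/n)$ at $r^k$ and $0$ at every $sr^k$. $\hat G$ is the set of $p$-regular elements of $G$ (order not divisible by $p$), and $\hat\psi_b=\psi_b|_{\hat G}$, $\hat\psi'_b=\psi'_b|_{\hat G}$. Symmetry classes: for $G\le S_m$ (here $m=4n$), let $\{e_1,\dots,e_k\}$ be an orthonormal basis of $V$, $k=\dim V$; $\Gamma^m_k$ is the set of sequences $\alpha=(\alpha_1,\dots,\alpha_m)$ with $1\le\alpha_i\le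 k$; $\alpha\sigma=(\alpha_{\sigma(1)},\dots,\alpha_{\sigma(m)})$ for $\sigma\in G$; $e_\alpha=e_{\alpha_1}\otimes\cdots\otimes e_{\alpha_m}$; $V^{\otimes m}$ has the induced inner product, for which the $e_\alpha$ are orthonormal. For $\phi:S\to\mathbb{C}$ (here $S=\hat G$), $$e^\phi_\alpha=\frac{\phi(e)}{|S|}\sum_{\sigma\in S}\phi(\sigma)e_{\alpha\sigma^{-1}},\qquad V_\phi(G)=\operatorname{span}\{e^\phi_\alpha:\alpha\in\Gamma^m_k\}.$$ An o-basis of a subspace $W\subseteq V_\phi(G)$ is an orthogonal basis of $W$ of the form $\{e^\phi_{\alpha_1},\dots,e^\phi_{\alpha_t}\}$ with $\alpha_i\in\Gamma^m_k$; the empty set is an o-basis of the zero subspace. *)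

theory Defs
  imports
    Complex_Main
    "HOL-Library.FuncSet"
    "HOL-Combinatorics.Cycles"
    "HOL-Algebra.Sym_Groups"
    "HOL-Algebra.Multiplicative_Group"
    "HOL-Computational_Algebra.Computational_Algebra"
begin

subsection \<open>Complex inner product spaces and tensor powers\<close>

locale complex_inner_space = vector_space scale
  for scale :: "complex \<Rightarrow> 'v::ab_group_add \<Rightarrow> 'v" +
  fixes ip :: "'v \<Rightarrow> 'v \<Rightarrow> complex"
  assumes ip_add_left: "ip (x + y) z = ip x z + ip y z"
    and ip_scale_left: "ip (scale c x) y = c * ip x y"
    and ip_commute: "ip x y = cnj (ip y x)"
    and ip_pos: "x \<noteq> 0 \<Longrightarrow> 0 < Re (ip x x)"
begin

definition orthonormal_basis :: "nat \<Rightarrow> (nat \<Rightarrow> 'v) \<Rightarrow> bool" where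
  "orthonormal_basis k e \<longleftrightarrow>
     (\<forall>i\<in>{1..k}. \<forall>j\<in>{1..k}. ip (e i) (e j) = (if i = j then 1 else 0)) \<and>
     span (e ` {1..k}) = UNIV"

definition orthogonal_basis_of :: "'v set \<Rightarrow> 'v set \<Rightarrow> bool" where
  "orthogonal_basis_of B U \<longleftrightarrow>
     independent B \<and> span B = U \<and> (\<forall>x\<in>B. \<forall>y\<in>B. x \<noteq> y \<longrightarrow> ip x y = 0)"

end

text \<open>The carrier \<open>T\<close>, a subspace of the inner product space on \<open>'w\<close>, is the
  \<open>m\<close>-fold tensor power of \<open>V\<close> with its induced inner product; \<open>tens v\<close> is
  \<open>v 1 \<otimes> \<dots> \<otimes> v m\<close>. The last two conditions determine
  \<open>(T, tens)\<close> up to a unique isometric isomorphism.\<close>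

locale tensor_power =
  V: complex_inner_space scaleV ipV + W: complex_inner_space scaleW ipW
  for scaleV :: "complex \<Rightarrow> 'v::ab_group_add \<Rightarrow> 'v" and ipV
    and scaleW :: "complex \<Rightarrow> 'w::ab_group_add \<Rightarrow> 'w" and ipW +
  fixes m :: nat and T :: "'w set" and tens :: "(nat \<Rightarrow> 'v) \<Rightarrow> 'w"
  assumes tens_add: "i \<in> {1..m} \<Longrightarrow>
        tens (v(i := x + y)) = tens (v(i := x)) + tens (v(i := y))"
    and tens_scale: "i \<in> {1..m} \<Longrightarrow>
        tens (v(i := scaleV c x)) = scaleW c (tens (v(i := x)))"
    and ip_tens: "ipW (tens v) (tens w) = (\<Prod>i\<in>{1..m}. ipV (v i) (w i))"
    and span_tens: "W.span (range tens) = T"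


subsection \<open>Symmetry classes of tensors\<close>

definition Gam :: "nat \<Rightarrow> nat \<Rightarrow> (nat \<Rightarrow> nat) set" where
  "Gam m k = {1..m} \<rightarrow>\<^sub>E {1..k}"

context complex_inner_space
begin

text \<open>\<open>E \<alpha>\<close> stands for the basis tensor indexed by \<open>\<alpha>\<close>; the action on
  index sequences is \<open>\<alpha>\<sigma> = \<alpha> \<circ> \<sigma>\<close>.\<close>

definition sym_tensor ::
  "nat \<Rightarrow> ((nat \<Rightarrow> nat) \<Rightarrow> 'v) \<Rightarrow> (nat \<Rightarrow> nat) set \<Rightarrow> ((nat \<Rightarrow> nat) \<Rightarrow> complex) \<Rightarrow>
     (nat \<Rightarrow> nat) \<Rightarrow> 'v" where
  "sym_tensor m E S \<phi> \<alpha> =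
     scale (\<phi> id / of_nat (card S))
       (\<Sum>\<sigma>\<in>S. scale (\<phi> \<sigma>) (E (\<alpha> \<circ> inv\<^bsub>sym_group m\<^esub> \<sigma>)))"

definition symmetry_class ::
  "nat \<Rightarrow> nat \<Rightarrow> ((nat \<Rightarrow> nat) \<Rightarrow> 'v) \<Rightarrow> (nat \<Rightarrow> nat) set \<Rightarrow> ((nat \<Rightarrow> nat) \<Rightarrow> complex) \<Rightarrow>
     'v set" where
  "symmetry_class m k E S \<phi> = span (sym_tensor m E S \<phi> ` Gam m k)"

definition has_o_basis ::
  "nat \<Rightarrow> nat \<Rightarrow> ((nat \<Rightarrow> nat) \<Rightarrow> 'v) \<Rightarrow> (nat \<Rightarrow> nat) set \<Rightarrow> ((nat \<Rightarrow> nat) \<Rightarrow> complex) \<Rightarrow>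
     'v set \<Rightarrow> bool" where
  "has_o_basis m k E S \<phi> U \<longleftrightarrow>
     (\<exists>A\<subseteq>Gam m k. orthogonal_basis_of (sym_tensor m E S \<phi> ` A) U)"

end


subsection \<open>The dicyclic group as a permutation group\<close>

definition dic_r :: "nat \<Rightarrow> nat \<Rightarrow> nat" where
  "dic_r n = cycle_of_list [1..<2*n+1] \<circ> cycle_of_list [2*n+1..<4*n+1]"

definition dic_s :: "nat \<Rightarrow> nat \<Rightarrow> nat" where
  "dic_s n = cycle_of_list [1, 2*n+1, n+1, 3*n+1] \<circ>
     foldr (\<lambda>i f. cycle_of_list [i, 4*n+2-i, n+i, 3*n+2-i] \<circ> f) [2..<n+1] id"

definition dicyclic :: "nat \<Rightarrow> (nat \<Rightarrow> nat) set" where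
  "dicyclic n = generate (sym_group (4*n)) {dic_r n, dic_s n}"

text \<open>\<open>dic_char n j\<close> is the two-dimensional irreducible character
  \<open>\<psi>\<^sub>j\<close> (\<open>n\<close> even) or \<open>\<psi>'\<^sub>j\<close> (\<open>n\<close> odd); its values are given by the same formula
  in both cases. The least exponent only serves to choose one; the value does not
  depend on it.\<close>

definition dic_char :: "nat \<Rightarrow> nat \<Rightarrow> (nat \<Rightarrow> nat) \<Rightarrow> complex" where
  "dic_char n j \<sigma> =
     (if \<exists>k. \<sigma> = dic_r n ^^ k
      then complex_of_real (2 * cos (real (LEAST k. \<sigma> = dic_r n ^^ k) * real j * pi / real n))
      else 0)"

definition p_regular :: "nat \<Rightarrow> nat \<Rightarrow> (nat \<Rightarrow> nat) set \<Rightarrow> (nat \<Rightarrow> nat) set" where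
  "p_regular p m G = {\<sigma> \<in> G. \<not> p dvd group.ord (sym_group m) \<sigma>}"


subsection \<open>The p-adic valuation on nonzero rationals\<close>

definition rat_val :: "nat \<Rightarrow> rat \<Rightarrow> int" where
  "rat_val p q =
     int (multiplicity (int p) (fst (quotient_of q))) -
     int (multiplicity (int p) (snd (quotient_of q)))"

end

theory Submission
  imports Defs
begin

text \<open>Only the rotations matter. The function \<open>\<phi>\<close> vanishes off the powers of \<open>r\<close>, and
  \<open>r ^ k\<close> is \<open>p\<close>-regular exactly when \<open>p ^ t\<close> divides \<open>k\<close>. So, with \<open>R = r ^ (p ^ t)\<close>, a permutation of
  order \<open>l\<close>, and \<open>\<theta> = 2 * \<pi> * b / l\<close>, the vector \<open>e\<^sup>\<phi>\<close> attached to \<open>\<alpha>\<close> is, up to a nonzero constant,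
  the cosine sum (\<open>cos_sum\<close> below) \<open>X \<alpha> = (\<Sum>j<l. cos (j * \<theta>) E (\<alpha> R ^ (-j)))\<close>
  (lemmas \<open>dic_r_pow_p_regular_iff\<close> and \<open>sum_p_regular_dic_char\<close>).

  Write \<open>g \<alpha> = \<alpha> R ^ (-1)\<close>. Index sequences in different \<open>g\<close>-orbits give
  orthogonal vectors, because they involve different basis tensors. Within an orbit two
  consequences of the addition formulas decide everything:
  \<^item> \<open>X (g ^ y \<alpha>) = cos (y * \<theta>) X \<alpha> + sin (y * \<theta>) Y \<alpha>\<close>, where \<open>Y\<close> is the corresponding sine sum; hence
    the vectors of one orbit span a space of dimension at most two (lemma \<open>cos_sum_rotate\<close>);
  \<^item> the inner product of \<open>X \<alpha>\<close> and \<open>X (g ^ y \<alpha>)\<close> is \<open>cos (y * \<theta>)\<close> times the squared norm of \<open>X \<alpha>\<close>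
    (lemma \<open>ip_cos_sum_same_orbit\<close>).

  If \<open>cos (j * \<theta>) = 0\<close> for some \<open>j\<close>, then \<open>X \<alpha>\<close> and \<open>X (g ^ j \<alpha>)\<close>, for one \<open>\<alpha>\<close> from each orbit with
  \<open>X \<alpha> \<noteq> 0\<close>, form an o-basis. If the cosine has no such zero, then an o-basis
  contains at most one vector from each orbit; but \<open>sin \<theta> \<noteq> 0\<close>, because \<open>0 < b < l / 2\<close>, so that \<open>X \<alpha>\<close> and \<open>X (g \<alpha>)\<close>
  are not parallel as soon as \<open>X \<alpha> \<noteq> 0\<close>, and one vector does not suffice. A sequence with
  \<open>X \<alpha> \<noteq> 0\<close> exists since \<open>dim V > 1\<close>: take one that differs at a single place from a constant one.
  Therefore an o-basis exists if and only if \<open>cos (j * \<theta>) = 0\<close> for some \<open>j\<close>. This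
  says that \<open>4 * b * j / l\<close> is an odd integer for some \<open>j\<close>, that is, that \<open>2 * b / l\<close> in lowest terms has an
  even denominator (lemma \<open>cos_zero_iff_rat_val\<close>).\<close>

section \<open>Orthogonality in complex inner product spaces\<close>

context complex_inner_space
begin

lemma ip_zero_left [simp]: "ip 0 y = 0"
  using ip_add_left[of 0 0 y] by simp

lemma ip_zero_right [simp]: "ip x 0 = 0"
  using ip_commute[of x 0] by simp

lemma ip_add_right: "ip x (y + z) = ip x y + ip x z"
  by (metis complex_cnj_add ip_add_left ip_commute)

lemma ip_scale_right: "ip x (scale c y) = cnj c * ip x y"
  by (metis complex_cnj_mult ip_commute ip_scale_left)

lemma ip_sum_left: "ip (\<Sum>i\<in>J. f i) y = (\<Sum>i\<in>J. ip (f i) y)"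
  by (induction J rule: infinite_finite_induct) (auto simp: ip_add_left)

lemma ip_sum_right: "ip x (\<Sum>i\<in>J. f i) = (\<Sum>i\<in>J. ip x (f i))"
  by (induction J rule: infinite_finite_induct) (auto simp: ip_add_right)

lemma ip_self_eq_0: "ip x x = 0 \<Longrightarrow> x = 0"
  using ip_pos[of x] by auto

lemma ip_eq_0_commute: "ip x y = 0 \<longleftrightarrow> ip y x = 0"
  using ip_commute[of x y] by auto

lemma span_orthogonal:
  assumes "\<And>b. b \<in> B \<Longrightarrow> ip x b = 0" and "y \<in> span B"
  shows "ip x y = 0"
  using assms(2)
  by (induction rule: span_induct_alt) (auto simp: ip_add_right ip_scale_right assms(1))

lemma orthogonal_imp_independent:
  assumes "0 \<notin> B" and "\<And>x y. x \<in> B \<Longrightarrow> y \<in> B \<Longrightarrow> x \<noteq> y \<Longrightarrow> ip x y = 0"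
  shows "independent B"
proof
  assume "dependent B"
  then obtain x where x: "x \<in> B" "x \<in> span (B - {x})"
    by (auto simp: dependent_def)
  have "ip x x = 0"
    by (rule span_orthogonal[OF _ x(2)]) (use assms x in auto)
  thus False using assms(1) x(1) ip_self_eq_0 by blast
qed

text \<open>Subtract from \<open>x\<close> the multiple of \<open>w\<close> that brings it into the span of \<open>B - {w}\<close>. The difference is
  still orthogonal to \<open>B - {w}\<close>, hence to itself.\<close>
lemma orthogonal_span_parallel:
  assumes x: "x \<in> span B" and w: "w \<in> B"
    and orth_w: "\<And>b. b \<in> B \<Longrightarrow> b \<noteq> w \<Longrightarrow> ip w b = 0"
    and orth_x: "\<And>b. b \<in> B \<Longrightarrow> b \<noteq> w \<Longrightarrow> ip x b = 0"
  shows "\<exists>c. x = scale c w"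
proof -
  obtain c where c: "x - scale c w \<in> span (B - {w})"
    using span_breakdown[OF w x] by blast
  define y where "y = x - scale c w"
  have x_eq: "x = y + scale c w" and y: "y \<in> span (B - {w})"
    using c by (simp_all add: y_def)
  have "ip y b = 0" if "b \<in> B - {w}" for b
    using that orth_w orth_x[of b] by (simp add: x_eq ip_add_left ip_scale_left)
  hence "ip y y = 0" using y by (rule span_orthogonal)
  hence "y = 0" by (rule ip_self_eq_0)
  thus ?thesis using x_eq by auto
qed

end

section \<open>Cosine sums over the orbits of a cyclic action\<close>

lemma sum_periodic_shift:
  fixes F :: "nat \<Rightarrow> 'a::ab_group_add"
  assumes "\<And>j. F (j + l) = F j"
  shows "(\<Sum>j<l. F (j + y)) = (\<Sum>j<l. F j)"
proof (induction y)
  case (Suc y)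
  have "F y + (\<Sum>j<l. F (j + Suc y)) = (\<Sum>j<Suc l. F (j + y))"
    by (subst sum.lessThan_Suc_shift) simp
  also have "\<dots> = (\<Sum>j<l. F (j + y)) + F y"
    using assms[of y] by (simp add: add.commute)
  finally show ?case using Suc by (simp add: add.commute)
qed simp

text \<open>An action of the cyclic group of order \<open>l\<close>, given by the map \<open>g\<close> of a generator, on the index
  set \<open>I\<close> of an orthonormal family. The condition on \<open>\<theta>\<close> says that it is an integer multiple of \<open>2 * \<pi> / l\<close>, so that
  \<open>cos (\<theta> * j)\<close> is a function on that group. The factor \<open>\<kappa>\<close> carries the normalisation of
  the symmetrised tensors.\<close>
locale cyclic_orbit_sums = complex_inner_space scale ip
  for scale :: "complex \<Rightarrow> 'v::ab_group_add \<Rightarrow> 'v" and ip +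
  fixes I :: "'i set" and g :: "'i \<Rightarrow> 'i" and E :: "'i \<Rightarrow> 'v"
    and l :: nat and \<theta> :: real and \<kappa> :: complex
  assumes g_closed: "\<alpha> \<in> I \<Longrightarrow> g \<alpha> \<in> I"
    and g_period: "\<alpha> \<in> I \<Longrightarrow> (g ^^ l) \<alpha> = \<alpha>"
    and l_pos: "0 < l"
    and theta_period: "cos (\<theta> * real l) = 1"
    and E_orthonormal: "\<alpha> \<in> I \<Longrightarrow> \<beta> \<in> I \<Longrightarrow> ip (E \<alpha>) (E \<beta>) = (if \<alpha> = \<beta> then 1 else 0)"
begin

definition cos_sum :: "'i \<Rightarrow> 'v" where
  "cos_sum \<alpha> = scale \<kappa> (\<Sum>j<l. scale (of_real (cos (\<theta> * real j))) (E ((g ^^ j) \<alpha>)))"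

definition sin_sum :: "'i \<Rightarrow> 'v" where
  "sin_sum \<alpha> = scale \<kappa> (\<Sum>j<l. scale (of_real (sin (\<theta> * real j))) (E ((g ^^ j) \<alpha>)))"

lemma gpow_closed: "\<alpha> \<in> I \<Longrightarrow> (g ^^ j) \<alpha> \<in> I"
  by (induction j) (auto intro: g_closed)

lemma gpow_add_l: "\<alpha> \<in> I \<Longrightarrow> (g ^^ (j + l)) \<alpha> = (g ^^ j) \<alpha>"
  by (simp add: funpow_add g_period)

lemma gpow_mult_l: "\<alpha> \<in> I \<Longrightarrow> (g ^^ (i * l)) \<alpha> = \<alpha>"
  by (induction i) (simp_all add: funpow_add g_period)

lemma gpow_inverse:
  assumes "\<alpha> \<in> I"
  shows "\<exists>z. (g ^^ z) ((g ^^ y) \<alpha>) = \<alpha>"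
proof
  have "(g ^^ (y * l - y)) ((g ^^ y) \<alpha>) = (g ^^ (y * l - y + y)) \<alpha>"
    by (simp add: funpow_add)
  also have "y * l - y + y = y * l" using l_pos by simp
  finally show "(g ^^ (y * l - y)) ((g ^^ y) \<alpha>) = \<alpha>" by (simp add: gpow_mult_l assms)
qed

lemma gpow_inj:
  assumes "\<alpha> \<in> I" "\<beta> \<in> I"
  shows "(g ^^ y) \<alpha> = (g ^^ y) \<beta> \<longleftrightarrow> \<alpha> = \<beta>"
proof
  assume eq: "(g ^^ y) \<alpha> = (g ^^ y) \<beta>"
  have "y * l = (y * l - y) + y" using l_pos by simp
  hence "\<And>\<gamma>. (g ^^ (y * l)) \<gamma> = (g ^^ (y * l - y)) ((g ^^ y) \<gamma>)"
    by (metis comp_apply funpow_add)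
  thus "\<alpha> = \<beta>" using eq assms by (metis gpow_mult_l)
qed simp

text \<open>Shifting the summation index by \<open>y\<close> replaces \<open>cos (\<theta> * j)\<close> by \<open>cos (\<theta> * (j - y))\<close>, which the
  addition formula splits.\<close>
lemma cos_sum_rotate:
  assumes "\<alpha> \<in> I"
  shows "cos_sum ((g ^^ y) \<alpha>) =
    scale (of_real (cos (\<theta> * real y))) (cos_sum \<alpha>) + scale (of_real (sin (\<theta> * real y))) (sin_sum \<alpha>)"
proof -
  define F where "F i = scale (of_real (cos (\<theta> * real i - \<theta> * real y))) (E ((g ^^ i) \<alpha>))" for i
  have sin_period: "sin (\<theta> * real l) = 0" using theta_period cos_one_sin_zero by blast
  have "cos (\<theta> * real (j + l) - \<theta> * real y) = cos (\<theta> * real j - \<theta> * real y)" for j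
  proof -
    have "cos (\<theta> * real (j + l) - \<theta> * real y) = cos ((\<theta> * real j - \<theta> * real y) + \<theta> * real l)"
      by (simp add: algebra_simps)
    thus ?thesis by (simp add: cos_add theta_period sin_period)
  qed
  hence per: "F (j + l) = F j" for j
    unfolding F_def using gpow_add_l[OF assms] by simp
  have "(\<Sum>j<l. scale (of_real (cos (\<theta> * real j))) (E ((g ^^ j) ((g ^^ y) \<alpha>)))) = (\<Sum>j<l. F (j + y))"
    by (intro sum.cong) (auto simp: F_def funpow_add distrib_left)
  also have "\<dots> = (\<Sum>j<l. F j)" using per by (rule sum_periodic_shift)
  also have "\<dots> = scale (of_real (cos (\<theta> * real y))) (\<Sum>j<l. scale (of_real (cos (\<theta> * real j))) (E ((g ^^ j) \<alpha>)))
     + scale (of_real (sin (\<theta> * real y))) (\<Sum>j<l. scale (of_real (sin (\<theta> * real j))) (E ((g ^^ j) \<alpha>)))"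
    unfolding scale_sum_right sum.distrib[symmetric] F_def
    by (intro sum.cong) (auto simp: cos_diff scale_left_distrib mult.commute)
  finally show ?thesis
    unfolding cos_sum_def sin_sum_def by (simp add: scale_right_distrib mult.commute)
qed

text \<open>The orthonormal family enters the inner products only through coincidences of indices. From this
  expansion one reads off that the inner products are symmetric (the coefficients are real), that
  they are invariant under \<open>g\<close>, and that they vanish between different orbits.\<close>
lemma ip_cos_sum:
  assumes "\<alpha> \<in> I" "\<beta> \<in> I"
  shows "ip (cos_sum \<alpha>) (cos_sum \<beta>) = \<kappa> * cnj \<kappa> *
    (\<Sum>j<l. \<Sum>i<l. of_real (cos (\<theta> * real i) * cos (\<theta> * real j)) *
       (if (g ^^ i) \<alpha> = (g ^^ j) \<beta> then 1 else 0))"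
  unfolding cos_sum_def
  by (simp add: ip_scale_left ip_scale_right ip_sum_left ip_sum_right sum_distrib_left
      E_orthonormal gpow_closed assms mult_ac)

lemma ip_cos_sum_commute:
  assumes "\<alpha> \<in> I" "\<beta> \<in> I"
  shows "ip (cos_sum \<alpha>) (cos_sum \<beta>) = ip (cos_sum \<beta>) (cos_sum \<alpha>)"
proof -
  have "ip (cos_sum \<alpha>) (cos_sum \<beta>) = \<kappa> * cnj \<kappa> *
    (\<Sum>i<l. \<Sum>j<l. of_real (cos (\<theta> * real i) * cos (\<theta> * real j)) *
       (if (g ^^ i) \<alpha> = (g ^^ j) \<beta> then 1 else 0))"
    unfolding ip_cos_sum[OF assms] by (subst sum.swap) simp
  also have "\<dots> = ip (cos_sum \<beta>) (cos_sum \<alpha>)"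
    unfolding ip_cos_sum[OF assms(2,1)]
    by (intro arg_cong2[where f="(*)"] refl sum.cong) (auto simp: mult.commute)
  finally show ?thesis .
qed

lemma ip_cos_sum_rotate:
  assumes "\<alpha> \<in> I" "\<beta> \<in> I"
  shows "ip (cos_sum ((g ^^ y) \<alpha>)) (cos_sum ((g ^^ y) \<beta>)) = ip (cos_sum \<alpha>) (cos_sum \<beta>)"
proof -
  have "(g ^^ i) ((g ^^ y) \<alpha>) = (g ^^ j) ((g ^^ y) \<beta>) \<longleftrightarrow> (g ^^ i) \<alpha> = (g ^^ j) \<beta>" for i j
  proof -
    have "(g ^^ i) ((g ^^ y) \<gamma>) = (g ^^ y) ((g ^^ i) \<gamma>)" for i \<gamma>
      by (metis add.commute comp_apply funpow_add)
    thus ?thesis using gpow_inj gpow_closed assms by simp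
  qed
  thus ?thesis by (simp add: ip_cos_sum assms gpow_closed)
qed

text \<open>With \<open>\<beta> = g ^ y \<alpha>\<close>, the vectors attached to \<open>g ^ y \<beta>\<close> and \<open>\<alpha>\<close> add up to \<open>2 * cos (\<theta> * y)\<close>
  times the one attached to \<open>\<beta>\<close>. By invariance and symmetry both
  have the same inner product with the latter.\<close>
lemma ip_cos_sum_same_orbit:
  assumes "\<alpha> \<in> I"
  shows "ip (cos_sum \<alpha>) (cos_sum ((g ^^ y) \<alpha>)) = of_real (cos (\<theta> * real y)) * ip (cos_sum \<alpha>) (cos_sum \<alpha>)"
proof -
  let ?\<beta> = "(g ^^ y) \<alpha>"
  let ?c = "complex_of_real (cos (\<theta> * real y))"
  have \<beta>: "?\<beta> \<in> I" using assms by (rule gpow_closed)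
  have "cos_sum ((g ^^ y) ?\<beta>) = cos_sum ((g ^^ (2 * y)) \<alpha>)"
    by (simp add: mult_2 funpow_add)
  also have "\<dots> = scale (of_real (cos (2 * (\<theta> * real y)))) (cos_sum \<alpha>)
      + scale (of_real (sin (2 * (\<theta> * real y)))) (sin_sum \<alpha>)"
    using cos_sum_rotate[OF assms, of "2 * y"] by (simp add: mult.left_commute)
  also have "\<dots> = scale (2 * ?c\<^sup>2 - 1) (cos_sum \<alpha>)
      + scale (2 * of_real (sin (\<theta> * real y)) * ?c) (sin_sum \<alpha>)"
    by (simp only: cos_double_cos sin_double) simp
  finally have "cos_sum ((g ^^ y) ?\<beta>) + cos_sum \<alpha> = scale (2 * ?c) (cos_sum ?\<beta>)"
    unfolding cos_sum_rotate[OF assms, of y]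
    by (simp add: scale_right_distrib scale_left_diff_distrib power2_eq_square algebra_simps)
  hence "ip (cos_sum ?\<beta>) (cos_sum ((g ^^ y) ?\<beta>)) + ip (cos_sum ?\<beta>) (cos_sum \<alpha>)
      = 2 * ?c * ip (cos_sum ?\<beta>) (cos_sum ?\<beta>)"
    by (simp flip: ip_add_right add: ip_scale_right)
  moreover have "ip (cos_sum ?\<beta>) (cos_sum ((g ^^ y) ?\<beta>)) = ip (cos_sum \<alpha>) (cos_sum ?\<beta>)"
    using ip_cos_sum_rotate[OF assms \<beta>] by simp
  moreover have "ip (cos_sum ?\<beta>) (cos_sum \<alpha>) = ip (cos_sum \<alpha>) (cos_sum ?\<beta>)"
    using ip_cos_sum_commute \<beta> assms by blast
  moreover have "ip (cos_sum ?\<beta>) (cos_sum ?\<beta>) = ip (cos_sum \<alpha>) (cos_sum \<alpha>)"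
    using ip_cos_sum_rotate[OF assms assms] by simp
  ultimately show ?thesis by simp
qed

definition orbit :: "'i \<Rightarrow> 'i set" where
  "orbit \<alpha> = range (\<lambda>y. (g ^^ y) \<alpha>)"

lemma orbit_self: "\<alpha> \<in> orbit \<alpha>"
  unfolding orbit_def by (rule range_eqI[where x = 0]) simp

lemma orbit_subset: "\<alpha> \<in> I \<Longrightarrow> orbit \<alpha> \<subseteq> I"
  unfolding orbit_def by (intro image_subsetI gpow_closed)

lemma orbit_eq:
  assumes "\<alpha> \<in> I" "\<beta> \<in> orbit \<alpha>"
  shows "orbit \<beta> = orbit \<alpha>"
proof -
  have sub: "orbit \<beta> \<subseteq> orbit \<alpha>" if mem: "\<beta> \<in> orbit \<alpha>" for \<alpha> \<beta>
  proof -
    obtain y where y: "\<beta> = (g ^^ y) \<alpha>" using mem unfolding orbit_def by blast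
    have "(g ^^ x) \<beta> = (g ^^ (x + y)) \<alpha>" for x by (simp add: y funpow_add)
    thus ?thesis unfolding orbit_def by auto
  qed
  obtain y where "\<beta> = (g ^^ y) \<alpha>" using assms(2) unfolding orbit_def by blast
  then obtain z where "(g ^^ z) \<beta> = \<alpha>" using gpow_inverse[OF assms(1)] by blast
  hence "\<alpha> \<in> orbit \<beta>" unfolding orbit_def by blast
  thus ?thesis using sub assms(2) by blast
qed

lemma ip_cos_sum_other_orbit:
  assumes "\<alpha> \<in> I" "\<beta> \<in> I" "\<beta> \<notin> orbit \<alpha>"
  shows "ip (cos_sum \<alpha>) (cos_sum \<beta>) = 0"
proof -
  have "(g ^^ i) \<alpha> \<noteq> (g ^^ j) \<beta>" for i j
  proof
    assume "(g ^^ i) \<alpha> = (g ^^ j) \<beta>"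
    hence "(g ^^ i) \<alpha> \<in> orbit \<alpha> \<inter> orbit \<beta>" unfolding orbit_def by (metis IntI rangeI)
    hence "orbit \<alpha> = orbit \<beta>" using orbit_eq assms by blast
    thus False using orbit_self[of \<beta>] assms(3) by simp
  qed
  thus ?thesis by (simp add: ip_cos_sum assms)
qed

text \<open>In a free orbit the indices \<open>g ^ j \<alpha>\<close> are distinct, so the coefficient of \<open>E \<alpha>\<close> in the
  cosine sum is \<open>\<kappa>\<close>.\<close>
lemma cos_sum_nonzero:
  assumes "\<alpha> \<in> I" "\<kappa> \<noteq> 0" and free: "\<And>j. 0 < j \<Longrightarrow> j < l \<Longrightarrow> (g ^^ j) \<alpha> \<noteq> \<alpha>"
  shows "cos_sum \<alpha> \<noteq> 0"
proof
  assume "cos_sum \<alpha> = 0"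
  have "ip (cos_sum \<alpha>) (E \<alpha>) = \<kappa> *
      (\<Sum>j<l. of_real (cos (\<theta> * real j)) * (if (g ^^ j) \<alpha> = \<alpha> then 1 else 0))"
    unfolding cos_sum_def
    by (simp add: ip_scale_left ip_sum_left E_orthonormal gpow_closed assms(1))
  also have "(\<Sum>j<l. of_real (cos (\<theta> * real j)) * (if (g ^^ j) \<alpha> = \<alpha> then 1 else 0)) =
      (\<Sum>j<l. if j = 0 then 1 else (0::complex))"
    by (intro sum.cong refl) (use free in auto)
  also have "\<dots> = 1" using l_pos by simp
  finally show False using \<open>cos_sum \<alpha> = 0\<close> assms(2) by simp
qed

text \<open>Without a zero of the cosine, two vectors from the same orbit are never orthogonal, so the
  basis contains just one vector \<open>w\<close> from some orbit. The vector next to \<open>w\<close> in this orbit is then a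
  multiple \<open>c w\<close>. Comparing inner products gives \<open>c = cos \<theta>\<close>, and comparing norms gives
  \<open>cos \<theta> ^ 2 = 1\<close>, against \<open>sin \<theta> \<noteq> 0\<close>.\<close>
lemma orthogonal_basis_imp_cos_zero:
  assumes A: "A \<subseteq> I" and basis: "orthogonal_basis_of (cos_sum ` A) (span (cos_sum ` I))"
    and \<alpha>: "\<alpha> \<in> I" "cos_sum \<alpha> \<noteq> 0" and "sin \<theta> \<noteq> 0"
  shows "\<exists>j::nat. cos (\<theta> * real j) = 0"
proof (rule ccontr)
  assume "\<not> ?thesis"
  hence cos_nz: "cos (\<theta> * real j) \<noteq> 0" for j :: nat by blast
  let ?B = "cos_sum ` A"
  have span_B: "cos_sum \<beta> \<in> span ?B" if "\<beta> \<in> I" for \<beta>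
    using basis that by (auto simp: orthogonal_basis_of_def intro: span_base)
  have orth_B: "ip x y = 0" if "x \<in> ?B" "y \<in> ?B" "x \<noteq> y" for x y
    using basis that by (auto simp: orthogonal_basis_of_def)
  have "0 \<notin> ?B" using basis dependent_zero by (auto simp: orthogonal_basis_of_def)
  \<comment> \<open>A nonzero vector of the span cannot be orthogonal to all of the basis.\<close>
  obtain \<beta> where \<beta>: "\<beta> \<in> A" "ip (cos_sum \<alpha>) (cos_sum \<beta>) \<noteq> 0"
    using span_orthogonal[OF _ span_B[OF \<alpha>(1)], of "cos_sum \<alpha>"] \<alpha>(2) ip_self_eq_0[of "cos_sum \<alpha>"]
    by blast
  have \<beta>I: "\<beta> \<in> I" using \<beta>(1) A by blast
  let ?w = "cos_sum \<beta>"
  have N: "ip ?w ?w \<noteq> 0" using \<open>0 \<notin> ?B\<close> \<beta>(1) ip_self_eq_0 by force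
  have orth_orbit: "ip (cos_sum (g \<beta>)) b = 0" if b: "b \<in> ?B" "b \<noteq> ?w" for b
  proof -
    obtain \<gamma> where \<gamma>: "\<gamma> \<in> A" "b = cos_sum \<gamma>" using b(1) by (elim imageE)
    have "ip ?w b = 0" using orth_B[OF imageI[OF \<beta>(1)] b(1)] b(2) by simp
    have "\<gamma> \<notin> orbit \<beta>"
    proof
      assume "\<gamma> \<in> orbit \<beta>"
      then obtain y where "\<gamma> = (g ^^ y) \<beta>" unfolding orbit_def by blast
      hence "ip ?w b = of_real (cos (\<theta> * real y)) * ip ?w ?w"
        using ip_cos_sum_same_orbit[OF \<beta>I] \<gamma>(2) by simp
      thus False using \<open>ip ?w b = 0\<close> cos_nz[of y] N by simp
    qed
    moreover have "g \<beta> \<in> orbit \<beta>" unfolding orbit_def by (rule range_eqI[where x = 1]) simp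
    ultimately show ?thesis
      using ip_cos_sum_other_orbit[of "g \<beta>" \<gamma>] orbit_eq[OF \<beta>I] g_closed[OF \<beta>I] \<gamma> A by blast
  qed
  have w: "?w \<in> ?B" using \<beta>(1) by (rule imageI)
  have orth_w: "ip ?w b = 0" if "b \<in> ?B" "b \<noteq> ?w" for b
    using orth_B[OF w that(1)] that(2) by simp
  obtain c where c: "cos_sum (g \<beta>) = scale c ?w"
    using orthogonal_span_parallel[OF span_B[OF g_closed[OF \<beta>I]] w orth_w orth_orbit] by auto
  have "cnj c * ip ?w ?w = of_real (cos \<theta>) * ip ?w ?w"
    using ip_cos_sum_same_orbit[OF \<beta>I, of 1] c by (simp add: ip_scale_right)
  hence "cnj c = of_real (cos \<theta>)" using N by simp
  hence c_eq: "c = of_real (cos \<theta>)" by (metis complex_cnj_cnj complex_cnj_complex_of_real)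
  have "cnj c * c * ip ?w ?w = ip ?w ?w"
    using ip_cos_sum_rotate[OF \<beta>I \<beta>I, of 1] c by (simp add: ip_scale_left ip_scale_right)
  hence "of_real ((cos \<theta>)\<^sup>2) = (1 :: complex)"
    using N by (simp add: c_eq power2_eq_square)
  hence "(cos \<theta>)\<^sup>2 = 1" by (simp only: of_real_eq_1_iff)
  thus False using \<open>sin \<theta> \<noteq> 0\<close> sin_cos_squared_add[of \<theta>] by simp
qed

text \<open>For a representative \<open>\<rho>\<close> of an orbit, \<open>cos (\<theta> * j) = 0\<close> makes the vectors of \<open>\<rho>\<close> and
  \<open>g ^ j \<rho>\<close> orthogonal. The latter is then the sine sum of \<open>\<rho>\<close> up to sign, so together they span the
  contribution of the orbit.\<close>
lemma cos_zero_imp_orthogonal_basis: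
  fixes j :: nat
  assumes "cos (\<theta> * real j) = 0"
  shows "\<exists>A\<subseteq>I. orthogonal_basis_of (cos_sum ` A) (span (cos_sum ` I))"
proof -
  define rep where "rep \<alpha> = (SOME \<beta>. \<beta> \<in> orbit \<alpha>)" for \<alpha>
  have rep_orbit: "rep \<alpha> \<in> orbit \<alpha>" for \<alpha>
    unfolding rep_def using orbit_self by (rule someI)
  have rep_eq: "rep \<beta> = rep \<alpha>" if "\<alpha> \<in> I" "\<beta> \<in> orbit \<alpha>" for \<alpha> \<beta>
    unfolding rep_def orbit_eq[OF that] ..
  have rep_I: "rep \<alpha> \<in> I" if "\<alpha> \<in> I" for \<alpha>
    using rep_orbit orbit_subset that by blast
  \<comment> \<open>Orbits on which the cosine sum vanishes contribute nothing and must be left out, since a basis does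
    not contain the zero vector.\<close>
  define A where "A = {\<alpha> \<in> I. cos_sum \<alpha> \<noteq> 0 \<and> (\<alpha> = rep \<alpha> \<or> \<alpha> = (g ^^ j) (rep \<alpha>))}"
  have orth: "ip (cos_sum \<alpha>) (cos_sum \<beta>) = 0"
    if \<alpha>: "\<alpha> \<in> A" and \<beta>: "\<beta> \<in> A" and ne: "cos_sum \<alpha> \<noteq> cos_sum \<beta>" for \<alpha> \<beta>
  proof (cases "\<beta> \<in> orbit \<alpha>")
    case False
    thus ?thesis using ip_cos_sum_other_orbit \<alpha> \<beta> by (auto simp: A_def)
  next
    case True
    have I: "\<alpha> \<in> I" "\<beta> \<in> I" using \<alpha> \<beta> by (auto simp: A_def)
    have 0: "ip (cos_sum (rep \<alpha>)) (cos_sum ((g ^^ j) (rep \<alpha>))) = 0"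
      using ip_cos_sum_same_orbit[OF rep_I[OF I(1)], of j] assms by simp
    have "rep \<beta> = rep \<alpha>" using rep_eq I(1) True by blast
    hence "\<alpha> = rep \<alpha> \<and> \<beta> = (g ^^ j) (rep \<alpha>) \<or> \<beta> = rep \<alpha> \<and> \<alpha> = (g ^^ j) (rep \<alpha>)"
      using \<alpha> \<beta> ne unfolding A_def by auto
    thus ?thesis using 0 ip_eq_0_commute by metis
  qed
  have "cos_sum \<beta> \<in> span (cos_sum ` A)" if \<beta>: "\<beta> \<in> I" for \<beta>
  proof -
    let ?\<rho> = "rep \<beta>"
    let ?s = "complex_of_real (sin (\<theta> * real j))"
    have \<rho>: "?\<rho> \<in> I" using rep_I \<beta> .
    have in_span: "cos_sum \<gamma> \<in> span (cos_sum ` A)" if "\<gamma> \<in> {?\<rho>, (g ^^ j) ?\<rho>}" for \<gamma>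
    proof -
      have \<gamma>: "\<gamma> \<in> orbit ?\<rho>"
        using that orbit_self by (auto simp: orbit_def)
      hence "rep \<gamma> = ?\<rho>" using rep_eq rep_orbit \<rho> \<beta> by metis
      hence "cos_sum \<gamma> = 0 \<or> \<gamma> \<in> A"
        using that \<gamma> orbit_subset[OF \<rho>] unfolding A_def by auto
      thus ?thesis using span_base span_zero by force
    qed
    have s2: "?s * ?s = 1"
    proof -
      have "(sin (\<theta> * real j))\<^sup>2 = 1" using sin_cos_squared_add[of "\<theta> * real j"] assms by simp
      thus ?thesis by (metis of_real_1 of_real_mult power2_eq_square)
    qed
    have "\<beta> \<in> orbit ?\<rho>" using rep_orbit orbit_eq orbit_self \<beta> by metis
    then obtain y where y: "\<beta> = (g ^^ y) ?\<rho>" unfolding orbit_def by blast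
    have "cos_sum ((g ^^ j) ?\<rho>) = scale ?s (sin_sum ?\<rho>)"
      using cos_sum_rotate[OF \<rho>, of j] assms by simp
    hence "sin_sum ?\<rho> = scale ?s (cos_sum ((g ^^ j) ?\<rho>))" using s2 by simp
    hence "cos_sum \<beta> = scale (of_real (cos (\<theta> * real y))) (cos_sum ?\<rho>) +
        scale (of_real (sin (\<theta> * real y)) * ?s) (cos_sum ((g ^^ j) ?\<rho>))"
      using cos_sum_rotate[OF \<rho>, of y] y by simp
    thus ?thesis using in_span by (simp add: span_add span_scale)
  qed
  hence "span (cos_sum ` I) \<subseteq> span (cos_sum ` A)"
    by (intro span_minimal) auto
  moreover have "span (cos_sum ` A) \<subseteq> span (cos_sum ` I)"
    by (intro span_mono image_mono) (auto simp: A_def)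
  moreover have "independent (cos_sum ` A)"
    by (intro orthogonal_imp_independent) (use orth in \<open>auto simp: A_def\<close>)
  ultimately have "orthogonal_basis_of (cos_sum ` A) (span (cos_sum ` I))"
    using orth unfolding orthogonal_basis_of_def by auto
  thus ?thesis by (intro exI[of _ A]) (auto simp: A_def)
qed

lemma orthogonal_basis_iff_cos_zero:
  assumes "\<alpha> \<in> I" "cos_sum \<alpha> \<noteq> 0" "sin \<theta> \<noteq> 0"
  shows "(\<exists>A\<subseteq>I. orthogonal_basis_of (cos_sum ` A) (span (cos_sum ` I))) \<longleftrightarrow>
    (\<exists>j::nat. cos (\<theta> * real j) = 0)"
  using orthogonal_basis_imp_cos_zero[OF _ _ assms] cos_zero_imp_orthogonal_basis by blast

end

section \<open>Rotations in the dicyclic group\<close>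

lemma dic_r_permutes: "dic_r n permutes {1..4 * n}"
  unfolding dic_r_def
  by (intro permutes_compose permutes_subset[OF cycle_permutes]) auto

lemma foldr_comp_permutes:
  assumes "\<And>i. i \<in> set xs \<Longrightarrow> c i permutes S"
  shows "foldr (\<lambda>i f. c i \<circ> f) xs id permutes S"
  using assms
proof (induction xs)
  case (Cons i xs)
  have eq: "foldr (\<lambda>i f. c i \<circ> f) (i # xs) id = c i \<circ> foldr (\<lambda>i f. c i \<circ> f) xs id"
    by (simp add: fun_eq_iff)
  have "c i \<circ> foldr (\<lambda>i f. c i \<circ> f) xs id permutes S"
    by (intro permutes_compose Cons.IH Cons.prems) simp_all
  thus ?case by (simp only: eq)
qed (simp add: permutes_id)

lemma dic_s_permutes:
  assumes "n \<ge> 1"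
  shows "dic_s n permutes {1..4 * n}"
  unfolding dic_s_def
proof (rule permutes_compose[OF foldr_comp_permutes])
  show "cycle_of_list [i, 4*n+2-i, n+i, 3*n+2-i] permutes {1..4 * n}" if "i \<in> set [2..<n+1]" for i
    by (rule permutes_subset[OF cycle_permutes]) (use that in auto)
  show "cycle_of_list [1, 2*n+1, n+1, 3*n+1] permutes {1..4 * n}"
    by (rule permutes_subset[OF cycle_permutes]) (use assms in auto)
qed

lemma funpow_comp_commute:
  assumes "f \<circ> g = g \<circ> f"
  shows "(f \<circ> g) ^^ k = f ^^ k \<circ> g ^^ k"
proof (induction k)
  case (Suc k)
  have comm: "f (g x) = g (f x)" for x using assms by (simp add: fun_eq_iff)
  have "g ((f ^^ k) x) = (f ^^ k) (g x)" for x
    by (induction k) (simp_all add: comm[symmetric])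
  thus ?case using Suc by (simp add: fun_eq_iff)
qed simp

lemma dic_r_pow:
  "dic_r n ^^ k = cycle_of_list [1..<2*n+1] ^^ k \<circ> cycle_of_list [2*n+1..<4*n+1] ^^ k"
  unfolding dic_r_def by (intro funpow_comp_commute cycles_commute) auto

lemma dic_r_pow_order: "dic_r n ^^ (2 * n) = id"
  using cycle_is_id_root[of "[1..<2*n+1]"] cycle_is_id_root[of "[2*n+1..<4*n+1]"]
  unfolding dic_r_pow by (simp del: upt_Suc)

text \<open>The orbit of the point \<open>1\<close> determines the exponent of a power of \<open>r\<close> modulo \<open>2 * n\<close>.\<close>
lemma dic_r_pow_1:
  assumes "n \<ge> 1"
  shows "(dic_r n ^^ k) 1 = k mod (2 * n) + 1"
proof -
  have "(cycle_of_list [2*n+1..<4*n+1] ^^ k) 1 = 1"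
    using assms by (induction k) (auto simp: id_outside_supp)
  hence "(dic_r n ^^ k) 1 = (cycle_of_list [1..<2*n+1] ^^ k) 1"
    unfolding dic_r_pow by simp
  also have "\<dots> = map (cycle_of_list [1..<2*n+1] ^^ k) [1..<2*n+1] ! 0"
    using assms by (subst nth_map) (auto simp del: upt_Suc)
  also have "\<dots> = rotate k [1..<2*n+1] ! 0"
    by (subst cyclic_rotation) auto
  also have "\<dots> = k mod (2 * n) + 1"
    using assms by (subst nth_rotate) (auto simp del: upt_Suc)
  finally show ?thesis .
qed

lemma dic_r_pow_mod: "dic_r n ^^ (k mod (2 * n)) = dic_r n ^^ k"
  by (rule ext, rule funpow_mod_eq) (simp add: dic_r_pow_order)

lemma dic_r_pow_eq_iff:
  assumes "n \<ge> 1"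
  shows "dic_r n ^^ i = dic_r n ^^ k \<longleftrightarrow> i mod (2 * n) = k mod (2 * n)"
proof
  assume "dic_r n ^^ i = dic_r n ^^ k"
  hence "(dic_r n ^^ i) 1 = (dic_r n ^^ k) 1" by simp
  thus "i mod (2 * n) = k mod (2 * n)" by (simp only: dic_r_pow_1[OF assms])
qed (metis dic_r_pow_mod)

lemma dic_char_pow:
  assumes "n \<ge> 1"
  shows "dic_char n j (dic_r n ^^ k) = of_real (2 * cos (real k * real j * pi / real n))"
proof -
  have cos_mod: "cos (real (i mod (2 * n)) * real j * pi / real n) = cos (real i * real j * pi / real n)" for i
  proof -
    have "real i = real (i div (2 * n) * (2 * n) + i mod (2 * n))"
      by (simp only: div_mult_mod_eq)
    hence "real i = real (i div (2 * n)) * (2 * real n) + real (i mod (2 * n))" by simp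
    hence "real i * real j * pi / real n =
        real (i mod (2 * n)) * real j * pi / real n + 2 * real (i div (2 * n) * j) * pi"
      using assms by (simp add: field_simps)
    thus ?thesis by (simp only: cos_add cos_2npi sin_2npi mult_1_right mult_zero_right diff_zero)
  qed
  define i where "i = (LEAST i. dic_r n ^^ k = dic_r n ^^ i)"
  have "dic_r n ^^ k = dic_r n ^^ i"
    unfolding i_def by (rule LeastI[of _ k]) (rule refl)
  hence "k mod (2 * n) = i mod (2 * n)" using dic_r_pow_eq_iff[OF assms] by blast
  hence "cos (real i * real j * pi / real n) = cos (real k * real j * pi / real n)"
    using cos_mod[of i] cos_mod[of k] by simp
  moreover have "\<exists>i. dic_r n ^^ k = dic_r n ^^ i" by blast
  ultimately show ?thesis unfolding dic_char_def i_def by simp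
qed

lemma sym_group_nat_pow: "x [^]\<^bsub>sym_group m\<^esub> (k::nat) = x ^^ k"
  by (induction k) (simp_all add: sym_group_one sym_group_mult nat_pow_def funpow_Suc_right del: funpow.simps)

text \<open>Finiteness is what keeps the sum over the \<open>p\<close>-regular elements, and its normalisation by their
  number, from collapsing to zero by convention.\<close>
lemma dicyclic_finite:
  assumes "n \<ge> 1"
  shows "finite (dicyclic n)"
proof -
  interpret S: group "sym_group (4 * n)" by (rule sym_group_is_group)
  have "dicyclic n \<subseteq> carrier (sym_group (4 * n))"
    unfolding dicyclic_def
    by (rule S.generate_incl) (use assms dic_r_permutes dic_s_permutes sym_group_carrier in auto)
  moreover have "finite (carrier (sym_group (4 * n)))"
    unfolding sym_group_def by (simp add: finite_permutations)
  ultimately show ?thesis by (rule finite_subset)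
qed

lemma dic_r_pow_in_dicyclic: "dic_r n ^^ k \<in> dicyclic n"
proof (induction k)
  case 0
  show ?case using generate.one[of "sym_group (4 * n)" "{dic_r n, dic_s n}"]
    unfolding dicyclic_def sym_group_one funpow.simps .
next
  case (Suc k)
  have "dic_r n \<in> dicyclic n" unfolding dicyclic_def by (rule generate.incl) simp
  from generate.eng[OF this[unfolded dicyclic_def] Suc[unfolded dicyclic_def]]
  show ?case unfolding dicyclic_def sym_group_mult funpow.simps .
qed

text \<open>The order \<open>d\<close> of \<open>r ^ k\<close> is characterised by \<open>d dvd i \<longleftrightarrow> 2 * n dvd k * i\<close>. If \<open>p\<close> does not divide
  \<open>d\<close>, the factor \<open>p ^ t\<close> of \<open>2 * n\<close>, which divides \<open>k * d\<close>, must divide \<open>k\<close>; if \<open>p ^ t\<close> divides \<open>k\<close>, then \<open>d\<close> divides \<open>l\<close>.\<close>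
lemma dic_r_pow_p_regular_iff:
  assumes "n \<ge> 1" "prime p" "2 * n = l * p ^ t" "\<not> p dvd l"
  shows "dic_r n ^^ k \<in> p_regular p (4 * n) (dicyclic n) \<longleftrightarrow> p ^ t dvd k"
proof -
  interpret S: group "sym_group (4 * n)" by (rule sym_group_is_group)
  have carr: "dic_r n ^^ k \<in> carrier (sym_group (4 * n))"
    using dic_r_permutes by (simp add: sym_group_carrier permutes_funpow)
  have ord: "S.ord (dic_r n ^^ k) dvd i \<longleftrightarrow> 2 * n dvd k * i" for i
  proof -
    have "S.ord (dic_r n ^^ k) dvd i \<longleftrightarrow> (dic_r n ^^ k) ^^ i = id"
      using S.pow_eq_id[OF carr, of i] by (simp add: sym_group_nat_pow sym_group_one)
    also have "\<dots> \<longleftrightarrow> dic_r n ^^ (k * i) = dic_r n ^^ 0"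
      by (simp add: funpow_mult mult.commute)
    also have "\<dots> \<longleftrightarrow> 2 * n dvd k * i"
      unfolding dic_r_pow_eq_iff[OF assms(1)] by (simp add: dvd_eq_mod_eq_0)
    finally show ?thesis .
  qed
  have "\<not> p dvd S.ord (dic_r n ^^ k) \<longleftrightarrow> p ^ t dvd k"
  proof
    assume "\<not> p dvd S.ord (dic_r n ^^ k)"
    hence "coprime (p ^ t) (S.ord (dic_r n ^^ k))"
      using assms(2) by (simp add: prime_imp_coprime)
    moreover have "p ^ t dvd k * S.ord (dic_r n ^^ k)"
      using ord[of "S.ord (dic_r n ^^ k)"] assms(3) dvd_trans[of "p ^ t" "2 * n"] by simp
    ultimately show "p ^ t dvd k" using coprime_dvd_mult_left_iff by blast
  next
    assume "p ^ t dvd k"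
    hence "2 * n dvd k * l" by (simp add: assms(3) mult.commute[of l] mult_dvd_mono)
    hence "S.ord (dic_r n ^^ k) dvd l" using ord by blast
    thus "\<not> p dvd S.ord (dic_r n ^^ k)" using assms(4) dvd_trans by blast
  qed
  thus ?thesis using dic_r_pow_in_dicyclic by (simp add: p_regular_def)
qed

text \<open>The character vanishes off the powers of \<open>r\<close>, and the \<open>p\<close>-regular ones among these are the powers of
  \<open>r ^ (p ^ t)\<close>. As \<open>2 * n = l * p ^ t\<close>, the angle \<open>p ^ t * j * b * \<pi> / n\<close> is \<open>2 * \<pi> * b * j / l\<close>.\<close>
lemma (in complex_inner_space) sum_p_regular_dic_char:
  assumes "n \<ge> 1" "prime p" "2 * n = l * p ^ t" "\<not> p dvd l"
  shows "(\<Sum>\<sigma>\<in>p_regular p (4 * n) (dicyclic n). scale (dic_char n b \<sigma>) (F \<sigma>)) =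
    (\<Sum>j<l. scale (of_real (2 * cos (2 * pi * real b / real l * real j))) (F (dic_r n ^^ (p ^ t * j))))"
    (is "sum ?f ?S = ?rhs")
proof -
  let ?R = "\<lambda>j. dic_r n ^^ (p ^ t * j)"
  have pos: "0 < l" "0 < p ^ t" using assms(1,3) prime_gt_0_nat[OF assms(2)] by (auto intro: Nat.gr0I)
  have exp_mod: "(p ^ t * j) mod (2 * n) = p ^ t * (j mod l)" for j
    by (simp only: assms(3) mult_mod_right mult.commute[of l])
  have R_mod: "?R (j mod l) = ?R j" for j
    using dic_r_pow_mod[of "p ^ t * j" n] by (simp only: exp_mod)
  have inj: "inj_on ?R {..<l}"
  proof (rule inj_onI)
    fix i j assume "i \<in> {..<l}" "j \<in> {..<l}" "?R i = ?R j"
    thus "i = j"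
      using pos prime_gt_0_nat[OF assms(2)] by (simp add: dic_r_pow_eq_iff[OF assms(1)] exp_mod)
  qed
  have zero: "?f \<sigma> = 0" if "\<sigma> \<in> ?S - ?R ` {..<l}" for \<sigma>
  proof -
    have "\<sigma> \<noteq> dic_r n ^^ k" for k
    proof
      assume k: "\<sigma> = dic_r n ^^ k"
      hence "p ^ t dvd k" using that dic_r_pow_p_regular_iff[OF assms] by simp
      then obtain j where "k = p ^ t * j" by (elim dvdE)
      hence "\<sigma> = ?R (j mod l)" using k R_mod by simp
      thus False using that pos by auto
    qed
    thus ?thesis by (simp add: dic_char_def)
  qed
  have "sum ?f ?S = sum ?f (?R ` {..<l})"
  proof (rule sum.mono_neutral_right)
    show "finite ?S" using dicyclic_finite[OF assms(1)] by (simp add: p_regular_def)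
    show "?R ` {..<l} \<subseteq> ?S"
      by (rule image_subsetI) (simp add: dic_r_pow_p_regular_iff[OF assms])
    show "\<forall>\<sigma>\<in>?S - ?R ` {..<l}. ?f \<sigma> = 0" by (rule ballI) (rule zero)
  qed
  also have "\<dots> = (\<Sum>j<l. ?f (?R j))" by (subst sum.reindex[OF inj]) (simp only: comp_def)
  also have "\<dots> = ?rhs"
  proof (intro sum.cong refl)
    fix j
    have "real (2 * n) = real (l * p ^ t)" by (simp only: assms(3))
    hence n_eq: "real n = real l * real (p ^ t) / 2" by simp
    have "real (p ^ t) * real j * real b * pi / (real l * real (p ^ t) / 2) =
        2 * pi * real b / real l * real j"
      using pos prime_gt_0_nat[OF assms(2)] by (simp add: field_simps)
    hence "real (p ^ t * j) * real b * pi / real n = 2 * pi * real b / real l * real j"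
      by (simp only: n_eq of_nat_mult)
    thus "?f (?R j) = scale (of_real (2 * cos (2 * pi * real b / real l * real j))) (F (?R j))"
      by (simp add: dic_char_pow[OF assms(1)])
  qed
  finally show ?thesis .
qed

section \<open>Zeros of the cosine and the 2-adic valuation\<close>

text \<open>Both sides say that the denominator \<open>v\<close> of \<open>a / l\<close> in lowest terms is even; if it is, the numerator
  \<open>i\<close> of the reduced fraction and \<open>j = v / 2\<close> satisfy the equation. Conversely, the equation says that \<open>2 * j\<close> times the reduced
  numerator equals \<open>i * v\<close>, and \<open>i\<close> is odd.\<close>
lemma rat_val_2_neg_iff:
  assumes "l > 0"
  shows "rat_val 2 (of_nat a / of_nat l) < 0 \<longleftrightarrow> (\<exists>(j::nat) i. odd i \<and> int (2 * j * a) = i * int l)"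
proof -
  obtain u v where uv: "quotient_of (of_nat a / of_nat l) = (u, v)" by force
  have v: "v > 0" and cop: "coprime u v"
    using uv quotient_of_denom_pos quotient_of_coprime by blast+
  have "of_nat a / of_nat l = (of_int u / of_int v :: rat)" using uv by (rule quotient_of_div)
  hence "of_int (int a * v) = (of_int (u * int l) :: rat)"
    using assms v by (simp add: field_simps)
  hence eq: "int a * v = u * int l" by (simp only: of_int_eq_iff)
  have "rat_val 2 (of_nat a / of_nat l) < 0 \<longleftrightarrow> even v"
  proof (cases "even v")
    case True
    hence "odd u" using cop by auto
    hence "multiplicity 2 u = 0" by (simp add: not_dvd_imp_multiplicity_0)
    moreover have "multiplicity 2 v > 0"
      using True v by (simp add: multiplicity_gt_zero_iff)
    ultimately show ?thesis using True by (simp add: rat_val_def uv)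
  next
    case False
    thus ?thesis by (simp add: rat_val_def uv not_dvd_imp_multiplicity_0)
  qed
  also have "\<dots> \<longleftrightarrow> (\<exists>(j::nat) i. odd i \<and> int (2 * j * a) = i * int l)"
  proof
    assume "even v"
    then obtain w where w: "v = 2 * w" by (elim dvdE)
    have "odd u" using cop \<open>even v\<close> by auto
    moreover have "int (2 * nat w * a) = u * int l" using eq v w by (simp add: mult_ac)
    ultimately show "\<exists>(j::nat) i. odd i \<and> int (2 * j * a) = i * int l" by blast
  next
    assume "\<exists>(j::nat) i. odd i \<and> int (2 * j * a) = i * int l"
    then obtain j :: nat and i where ij: "odd i" "int (2 * j * a) = i * int l" by blast
    have "2 * int j * u * int l = i * v * int l"
    proof -
      have "2 * int j * u * int l = 2 * int j * (int a * v)" by (simp add: eq)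
      also have "\<dots> = int (2 * j * a) * v" by simp
      also have "\<dots> = i * v * int l" unfolding ij(2) by simp
      finally show ?thesis .
    qed
    hence "2 * int j * u = i * v" using assms by simp
    hence "even (i * v)" by (metis dvd_triv_left mult.assoc)
    thus "even v" using ij(1) by simp
  qed
  finally show ?thesis .
qed

lemma cos_zero_iff_rat_val:
  assumes "l > 0"
  shows "(\<exists>j::nat. cos (2 * pi * real b / real l * real j) = 0) \<longleftrightarrow>
    rat_val 2 (of_nat (2 * b) / of_nat l) < 0"
proof -
  have "cos (2 * pi * real b / real l * real j) = 0 \<longleftrightarrow>
      (\<exists>i. odd i \<and> int (2 * j * (2 * b)) = i * int l)" for j :: nat
  proof -
    have "2 * pi * real b / real l * real j = of_int i * (pi / 2) \<longleftrightarrow>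
        int (2 * j * (2 * b)) = i * int l" for i
    proof -
      have "2 * pi * real b / real l * real j = of_int i * (pi / 2) \<longleftrightarrow>
          real_of_int (int (2 * j * (2 * b))) = real_of_int (i * int l)"
        using assms by (auto simp: field_simps)
      thus ?thesis by (simp only: of_int_eq_iff)
    qed
    thus ?thesis unfolding cos_zero_iff_int by simp
  qed
  thus ?thesis unfolding rat_val_2_neg_iff[OF assms] by simp
qed

section \<open>The symmetry class of the dicyclic group\<close>

lemma (in tensor_power) basis_tensors_orthonormal:
  assumes "V.orthonormal_basis k e" "\<alpha> \<in> Gam m k" "\<beta> \<in> Gam m k"
  shows "ipW (tens (\<lambda>i. e (\<alpha> i))) (tens (\<lambda>i. e (\<beta> i))) = (if \<alpha> = \<beta> then 1 else 0)"
proof -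
  have "ipW (tens (\<lambda>i. e (\<alpha> i))) (tens (\<lambda>i. e (\<beta> i))) = (\<Prod>i\<in>{1..m}. if \<alpha> i = \<beta> i then 1 else 0)"
    unfolding ip_tens
  proof (intro prod.cong refl)
    fix i assume "i \<in> {1..m}"
    hence "\<alpha> i \<in> {1..k}" "\<beta> i \<in> {1..k}" using assms(2,3) by (auto simp: Gam_def)
    thus "ipV (e (\<alpha> i)) (e (\<beta> i)) = (if \<alpha> i = \<beta> i then 1 else 0)"
      using assms(1) unfolding V.orthonormal_basis_def by blast
  qed
  also have "\<dots> = (if \<alpha> = \<beta> then 1 else 0)"
  proof (cases "\<alpha> = \<beta>")
    case False
    then obtain i where "i \<in> {1..m}" "\<alpha> i \<noteq> \<beta> i"
      using assms(2,3) unfolding Gam_def by (metis PiE_ext)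
    thus ?thesis using False by (auto intro: prod_zero)
  qed simp
  finally show ?thesis .
qed

lemma Gam_comp_permutes:
  assumes "\<sigma> permutes {1..m}" "\<alpha> \<in> Gam m k"
  shows "\<alpha> \<circ> \<sigma> \<in> Gam m k"
  using assms(2) permutes_in_image[OF assms(1)] permutes_not_in[OF assms(1)]
  unfolding Gam_def PiE_iff extensional_def by auto

lemma funpow_comp_right:
  fixes \<tau> :: "'a \<Rightarrow> 'a"
  shows "((\<lambda>\<alpha>. \<alpha> \<circ> \<tau>) ^^ j) \<alpha> = \<alpha> \<circ> \<tau> ^^ j"
proof (induction j)
  case (Suc j)
  have "((\<lambda>\<alpha>. \<alpha> \<circ> \<tau>) ^^ Suc j) \<alpha> = ((\<lambda>\<alpha>. \<alpha> \<circ> \<tau>) ^^ j) \<alpha> \<circ> \<tau>" by simp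
  also have "\<dots> = \<alpha> \<circ> \<tau> ^^ Suc j" by (simp only: Suc comp_assoc funpow_Suc_right)
  finally show ?case .
qed simp

theorem theorem4p5:
  fixes scaleV :: "complex \<Rightarrow> 'v::ab_group_add \<Rightarrow> 'v"
    and ipV :: "'v \<Rightarrow> 'v \<Rightarrow> complex"
    and scaleW :: "complex \<Rightarrow> 'w::ab_group_add \<Rightarrow> 'w"
    and ipW :: "'w \<Rightarrow> 'w \<Rightarrow> complex"
    and T :: "'w set" and tens :: "(nat \<Rightarrow> 'v) \<Rightarrow> 'w"
    and e :: "nat \<Rightarrow> 'v"
    and n k p l t b :: nat
    and G Ghat :: "(nat \<Rightarrow> nat) set" and \<phi> :: "(nat \<Rightarrow> nat) \<Rightarrow> complex"
    and E :: "(nat \<Rightarrow> nat) \<Rightarrow> 'w"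
  assumes V: "complex_inner_space scaleV ipV"
    and k: "k = vector_space.dim scaleV (UNIV :: 'v set)" "k > 1"
    and e: "complex_inner_space.orthonormal_basis scaleV ipV k e"
    and T: "tensor_power scaleV ipV scaleW ipW (4 * n) T tens"
    and E: "E = (\<lambda>\<alpha>. tens (\<lambda>i. e (\<alpha> i)))"
    and n: "n \<ge> 1"
    and p: "prime p"
    and l: "2 * n = l * p ^ t" "\<not> p dvd l"
    and b: "1 \<le> b" "real b < real l / 2"
    and G: "G = dicyclic n"
    and Ghat: "Ghat = p_regular p (4 * n) G"
    and \<phi>: "\<phi> = restrict (dic_char n b) Ghat"
  shows "complex_inner_space.has_o_basis scaleW ipW (4 * n) k E Ghat \<phi>
           (complex_inner_space.symmetry_class scaleW (4 * n) k E Ghat \<phi>)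
         \<longleftrightarrow> rat_val 2 (of_nat (2 * b) / of_nat l) < 0"
proof -
  interpret T: tensor_power scaleV ipV scaleW ipW "4 * n" T tens by (rule T)
  define R where "R = dic_r n ^^ (p ^ t)"
  define g where "g = (\<lambda>\<alpha> :: nat \<Rightarrow> nat. \<alpha> \<circ> inv_into UNIV R)"
  define \<theta> where "\<theta> = 2 * pi * real b / real l"
  \<comment> \<open>The factor 2 is the one in the character value \<open>2 * cos (\<theta> * j)\<close>.\<close>
  define \<kappa> where "\<kappa> = \<phi> id / of_nat (card Ghat) * 2"
  have l_pos: "l > 0" using b by (auto intro: Nat.gr0I)
  have \<theta>_l: "\<theta> * real l = 2 * real b * pi" using l_pos by (simp add: \<theta>_def)
  have R_perm: "R ^^ j permutes {1..4 * n}" for j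
    unfolding R_def using dic_r_permutes by (intro permutes_funpow)
  have R_pow: "R ^^ j = dic_r n ^^ (p ^ t * j)" for j
    by (simp add: R_def funpow_mult mult.commute)
  have bij_R: "bij R" using R_perm[of 1] by (simp add: permutes_bij)
  have g_pow: "(g ^^ j) \<alpha> = \<alpha> \<circ> inv_into UNIV (R ^^ j)" for j \<alpha>
    unfolding g_def funpow_comp_right inv_fn[OF bij_R] ..
  have inv_R: "inv\<^bsub>sym_group (4 * n)\<^esub> (R ^^ j) = inv_into UNIV (R ^^ j)" for j
    using R_perm by (intro sym_group_inv_equality) (simp only: sym_group_carrier)
  have R_l: "R ^^ l = id"
    by (simp add: R_pow mult.commute[of _ l] dic_r_pow_order flip: l(1))
  interpret S: cyclic_orbit_sums scaleW ipW "Gam (4 * n) k" g E l \<theta> \<kappa>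
  proof
    show "g \<alpha> \<in> Gam (4 * n) k" if "\<alpha> \<in> Gam (4 * n) k" for \<alpha>
      unfolding g_def using that R_perm[of 1] by (intro Gam_comp_permutes permutes_inv) auto
    show "(g ^^ l) \<alpha> = \<alpha>" for \<alpha>
      unfolding g_pow R_l by simp
    show "cos (\<theta> * real l) = 1" unfolding \<theta>_l by (rule cos_2npi)
    show "ipW (E \<alpha>) (E \<beta>) = (if \<alpha> = \<beta> then 1 else 0)"
      if "\<alpha> \<in> Gam (4 * n) k" "\<beta> \<in> Gam (4 * n) k" for \<alpha> \<beta>
      unfolding E using T.basis_tensors_orthonormal[OF e that] .
  qed (fact l_pos)

  have "id \<in> Ghat"
    using dic_r_pow_p_regular_iff[OF n p l, of 0] by (simp add: Ghat G id_def)
  hence "\<phi> id = 2"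
    using dic_char_pow[OF n, of b 0] by (simp add: \<phi> id_def)
  moreover have "card Ghat \<noteq> 0"
    using \<open>id \<in> Ghat\<close> dicyclic_finite[OF n] by (auto simp: Ghat G p_regular_def)
  ultimately have \<kappa>_nz: "\<kappa> \<noteq> 0" by (simp add: \<kappa>_def)

  have sym: "T.W.sym_tensor (4 * n) E Ghat \<phi> \<alpha> = S.cos_sum \<alpha>" for \<alpha>
  proof -
    have "(\<Sum>\<sigma>\<in>Ghat. scaleW (\<phi> \<sigma>) (E (\<alpha> \<circ> inv\<^bsub>sym_group (4 * n)\<^esub> \<sigma>))) =
        (\<Sum>\<sigma>\<in>Ghat. scaleW (dic_char n b \<sigma>) (E (\<alpha> \<circ> inv\<^bsub>sym_group (4 * n)\<^esub> \<sigma>)))"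
      by (intro sum.cong) (auto simp: \<phi>)
    also have "\<dots> = (\<Sum>j<l. scaleW (of_real (2 * cos (\<theta> * real j))) (E ((g ^^ j) \<alpha>)))"
      unfolding Ghat G T.W.sum_p_regular_dic_char[OF n p l]
      by (simp only: \<theta>_def g_pow inv_R flip: R_pow)
    also have "\<dots> = scaleW 2 (\<Sum>j<l. scaleW (of_real (cos (\<theta> * real j))) (E ((g ^^ j) \<alpha>)))"
      by (simp add: T.W.scale_sum_right)
    finally show ?thesis
      by (simp only: T.W.sym_tensor_def S.cos_sum_def T.W.scale_scale \<kappa>_def[symmetric])
  qed

  have sin_nz: "sin \<theta> \<noteq> 0"
  proof -
    have "0 < \<theta>" using b l_pos by (simp add: \<theta>_def)
    moreover have "\<theta> < pi"
      using b l_pos by (simp add: \<theta>_def field_simps)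
    ultimately show ?thesis using sin_gt_zero by force
  qed

  \<comment> \<open>This sequence marks the point 1, which no nontrivial power of \<open>R\<close> fixes, so its orbit is free. It
    needs two different entries, hence \<open>k > 1\<close>.\<close>
  define \<alpha> where "\<alpha> = (\<lambda>i\<in>{1..4 * n}. if i = 1 then 1 else (2::nat))"
  have \<alpha>: "\<alpha> \<in> Gam (4 * n) k" using k(2) by (auto simp: \<alpha>_def Gam_def)
  have \<alpha>_1: "\<alpha> 1 = 1" using n by (simp add: \<alpha>_def)
  have \<alpha>_eq_1: "i = 1" if "i \<in> {1..4 * n}" "\<alpha> i = 1" for i
  proof (rule ccontr)
    assume "i \<noteq> 1"
    hence "\<alpha> i = 2" unfolding \<alpha>_def restrict_apply'[OF that(1)] by (rule if_not_P)
    thus False using that(2) by simp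
  qed
  have "S.cos_sum \<alpha> \<noteq> 0"
  proof (rule S.cos_sum_nonzero[OF \<alpha> \<kappa>_nz])
    fix j assume j: "0 < j" "j < l"
    show "(g ^^ j) \<alpha> \<noteq> \<alpha>"
    proof
      assume "(g ^^ j) \<alpha> = \<alpha>"
      hence "(\<alpha> \<circ> inv_into UNIV (R ^^ j)) ((R ^^ j) 1) = \<alpha> ((R ^^ j) 1)"
        unfolding g_pow by (rule fun_cong)
      hence val: "\<alpha> ((R ^^ j) 1) = 1"
        by (simp only: comp_apply permutes_inverses(2)[OF R_perm] \<alpha>_1)
      have "(R ^^ j) 1 \<in> {1..4 * n}"
        using n permutes_in_image[OF R_perm, of j 1] by simp
      hence "(R ^^ j) 1 = 1" using val by (rule \<alpha>_eq_1)
      hence "(p ^ t * j) mod (2 * n) = 0"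
        unfolding R_pow dic_r_pow_1[OF n] by simp
      hence "2 * n dvd p ^ t * j" by (rule mod_0_imp_dvd)
      hence "p ^ t * l dvd p ^ t * j" by (simp only: l(1) mult.commute[of l])
      hence "l dvd j" using prime_gt_0_nat[OF p] by simp
      thus False using j by (auto dest: dvd_imp_le)
    qed
  qed
  from S.orthogonal_basis_iff_cos_zero[OF \<alpha> this sin_nz]
  have "T.W.has_o_basis (4 * n) k E Ghat \<phi> (T.W.symmetry_class (4 * n) k E Ghat \<phi>) \<longleftrightarrow>
      (\<exists>j::nat. cos (\<theta> * real j) = 0)"
    unfolding T.W.has_o_basis_def T.W.symmetry_class_def sym .
  also have "\<dots> \<longleftrightarrow> rat_val 2 (of_nat (2 * b) / of_nat l) < 0"
    unfolding \<theta>_def by (rule cos_zero_iff_rat_val[OF l_pos])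
  finally show ?thesis .
qed

end
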